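(* Weak duality holds for M-CLP and M-CLP$^*$: for every feasible solution $U$ of M-CLP and every feasible solution $P$ of M-CLP$^*$, $$\int_{0-}^T(\gamma+(T-t)c)^{T}dU(t)\ \le\ \int_{0-}^T(\beta+(T-t)b)^{T}dP(t).$$
   Context: Let $T>0$, $A$ a constant $K\times J$ matrix, $\beta,b\in\mathbb R^K$, $\gamma,c\in\mathbb R^J$ constant vectors. Superscript $T$ on vectors/matrices is transpose; vector inequalities are componentwise. M-CLP: maximize $\int_{0-}^T(\gamma+(T-t)c)^{T}dU(t)$ subject to $AU(t)\le\beta+bt$ for $0\le t\le T$, where $U:[0,T]\to\mathbb R^J$ is non-negative, (componentwise) non-decreasing and right-continuous. M-CLP$^*$: minimize $\int_{0-}^T(\beta+(T-t)b)^{T}dP(t)$ subject to $A^{T}P(t)\ge\gamma+ct$ for $0\le t\le T$, where $P:[0,T]\to\mathbb R^K$ is non-negative, (componentwise) non-decreasing and right-continuous. Integrals are Lebesgue–Stieltjes over $[0,T]$ with the convention $U(0-)=0$, $P(0-)=0$, so atoms at $0$ (of sizes $U(0)$, $P(0)$) and at $T$ are included. *)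

theory Defs
  imports "HOL-Analysis.Analysis"
begin

(* Only the values of a control on [0,T] matter.  Vector inequalities are the componentwise
   order of the type vec.  No right-hand limit is required at the end point T. *)
definition admissible_control :: "real \<Rightarrow> (real \<Rightarrow> real ^ 'n) \<Rightarrow> bool" where
  "admissible_control T F \<longleftrightarrow>
     (\<forall>t\<in>{0..T}. 0 \<le> F t) \<and>
     mono_on {0..T} F \<and>
     (\<forall>t\<in>{0..<T}. continuous (at_right t) F)"

(* Encodes the convention F(0-) = 0: the jump at 0 has size F 0, and there is no mass outside [0,T]. *)
definition stieltjes_extension :: "real \<Rightarrow> (real \<Rightarrow> real) \<Rightarrow> real \<Rightarrow> real" where
  "stieltjes_extension T F t = (if t < 0 then 0 else F (min t T))"

definition stieltjes_integral :: "real \<Rightarrow> (real \<Rightarrow> real ^ 'n) \<Rightarrow> (real \<Rightarrow> real ^ 'n) \<Rightarrow> real" where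
  "stieltjes_integral T f F =
     (\<Sum>i\<in>UNIV. LINT t:{0..T}|interval_measure (stieltjes_extension T (\<lambda>s. F s $ i)). f t $ i)"

definition mclp_feasible ::
  "real \<Rightarrow> real ^ 'j ^ 'k \<Rightarrow> real ^ 'k \<Rightarrow> real ^ 'k \<Rightarrow> (real \<Rightarrow> real ^ 'j) \<Rightarrow> bool" where
  "mclp_feasible T A \<beta> b U \<longleftrightarrow>
     admissible_control T U \<and> (\<forall>t\<in>{0..T}. A *v U t \<le> \<beta> + t *\<^sub>R b)"

definition mclp_objective ::
  "real \<Rightarrow> real ^ 'j \<Rightarrow> real ^ 'j \<Rightarrow> (real \<Rightarrow> real ^ 'j) \<Rightarrow> real" where
  "mclp_objective T \<gamma> c U = stieltjes_integral T (\<lambda>t. \<gamma> + (T - t) *\<^sub>R c) U"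

definition mclp_dual_feasible ::
  "real \<Rightarrow> real ^ 'j ^ 'k \<Rightarrow> real ^ 'j \<Rightarrow> real ^ 'j \<Rightarrow> (real \<Rightarrow> real ^ 'k) \<Rightarrow> bool" where
  "mclp_dual_feasible T A \<gamma> c P \<longleftrightarrow>
     admissible_control T P \<and> (\<forall>t\<in>{0..T}. transpose A *v P t \<ge> \<gamma> + t *\<^sub>R c)"

definition mclp_dual_objective ::
  "real \<Rightarrow> real ^ 'k \<Rightarrow> real ^ 'k \<Rightarrow> (real \<Rightarrow> real ^ 'k) \<Rightarrow> real" where
  "mclp_dual_objective T \<beta> b P = stieltjes_integral T (\<lambda>t. \<beta> + (T - t) *\<^sub>R b) P"

end

theory Submission
  imports Defs
begin

text \<open>
  The proof is the classical chain of weak duality, with time reversal in place of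
  transposition. Integrating the dual constraint at time \<open>T - t\<close> against the positive
  measure \<open>dU\<close>, and the primal constraint at time \<open>T - s\<close> against \<open>dP\<close>, gives
  \[
    \int (\gamma + (T-t)c)^T dU(t) \le \int (A^T P(T-t))^T dU(t)
    = \int (A\,U(T-s))^T dP(s) \le \int (\beta + (T-s)b)^T dP(s).
  \]
  The equality in the middle reduces to the scalar identity
  \<open>set_integral_reflected_distribution_swap\<close>: as \<open>F(0-) = 0\<close>, the value \<open>F r\<close> is the mass that
  \<open>dF\<close> gives to \<open>{0..r}\<close>, so both sides are the mass that the product of the two
  Stieltjes measures gives to the triangle \<open>0 \<le> t\<close>, \<open>0 \<le> s\<close>, \<open>t + s \<le> T\<close>, and Tonelli's
  theorem applies. Both sides include the hypotenuse \<open>t + s = T\<close>: right-continuity puts an atom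
  at \<open>r\<close> into \<open>F r\<close>, so common atoms of \<open>dU\<close> and the reflected \<open>dP\<close> leave no correction
  term of the kind that integration by parts produces for jumps.
\<close>

section \<open>Stieltjes measures on the half-line\<close>

definition half_line_distribution :: "(real \<Rightarrow> real) \<Rightarrow> bool" where
  "half_line_distribution F \<longleftrightarrow>
     mono F \<and> (\<forall>a. continuous (at_right a) F) \<and> (\<forall>t<0. F t = 0)"

lemma half_line_distribution_nonneg:
  assumes "half_line_distribution F"
  shows "0 \<le> F t"
proof -
  have "mono F" "F (min t (-1)) = 0"
    using assms by (simp_all add: half_line_distribution_def)
  then show ?thesis using monoD[of F "min t (-1)" t] by simp
qed

lemma half_line_distribution_borel:
  "half_line_distribution F \<Longrightarrow> F \<in> borel_measurable borel"
  by (simp add: half_line_distribution_def borel_measurable_mono)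

lemma half_line_distribution_sigma_finite:
  "half_line_distribution F \<Longrightarrow> sigma_finite_measure (interval_measure F)"
  by (rule sigma_finite_interval_measure) (auto simp: half_line_distribution_def dest: monoD)

text \<open>
  Half-open intervals \<open>{a<..b}\<close> have mass \<open>F b - F a\<close>. The closed interval differs from
  \<open>{-1<..r}\<close> by \<open>{-1<..<0}\<close>, which is exhausted by half-open intervals on which \<open>F\<close> vanishes;
  hence the atom at \<open>0\<close> is counted in full.
\<close>
lemma emeasure_interval_measure_zero_Icc:
  assumes F: "half_line_distribution F"
  shows "emeasure (interval_measure F) {0..r} = ennreal (F r)"
proof (cases "r < 0")
  case True
  then show ?thesis using F by (simp add: half_line_distribution_def)
next
  case False
  let ?M = "interval_measure F"
  have Ioc: "emeasure ?M {a<..b} = ennreal (F b - F a)" if "a \<le> b" for a b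
    using F that by (intro emeasure_interval_measure_Ioc)
      (auto simp: half_line_distribution_def dest: monoD)
  have "{-1<..- inverse (real (Suc n))} \<in> null_sets ?M" for n
    using F Ioc[of "-1" "- inverse (real (Suc n))"]
    by (auto simp: null_sets_def half_line_distribution_def inverse_le_1_iff)
  then have "(\<Union>n. {-1<..- inverse (real (Suc n))}) \<in> null_sets ?M"
    by (rule null_sets_UN)
  moreover have "{-1<..<0} \<subseteq> (\<Union>n. {-1<..- inverse (real (Suc n))})"
  proof
    fix x :: real assume x: "x \<in> {-1<..<0}"
    then obtain n where "inverse (real (Suc n)) < - x"
      using reals_Archimedean[of "- x"] by auto
    then show "x \<in> (\<Union>n. {-1<..- inverse (real (Suc n))})"
      using x by (auto intro!: exI[of _ n])
  qed
  moreover have "{-1<..<0::real} \<in> sets ?M" by simp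
  ultimately have null: "{-1<..<0::real} \<in> null_sets ?M"
    by (metis null_sets_subset)
  have "{-1<..r} = {0..r} \<union> {-1<..<0}" using False by auto
  then have "emeasure ?M {0..r} = emeasure ?M {-1<..r}"
    using null by (simp add: emeasure_Un_null_set)
  also have "\<dots> = ennreal (F r)"
    using F False by (simp add: Ioc half_line_distribution_def)
  finally show ?thesis .
qed

lemma set_integrable_interval_measure_bounded:
  fixes f :: "real \<Rightarrow> real"
  assumes F: "half_line_distribution F"
    and [measurable]: "f \<in> borel_measurable borel"
    and bnd: "\<And>t. t \<in> {0..T} \<Longrightarrow> \<bar>f t\<bar> \<le> B"
  shows "set_integrable (interval_measure F) {0..T} f"
  unfolding set_integrable_def
  by (rule integrableI_bounded_set_indicator[where B = B])
    (use bnd in \<open>auto simp: emeasure_interval_measure_zero_Icc[OF F]\<close>)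

lemma set_integrable_reflected_distribution:
  assumes F: "half_line_distribution F" and G: "half_line_distribution G"
  shows "set_integrable (interval_measure F) {0..T} (\<lambda>t. G (T - t))"
proof (rule set_integrable_interval_measure_bounded[OF F, where B = "G T"])
  note half_line_distribution_borel[OF G, measurable]
  show "(\<lambda>t. G (T - t)) \<in> borel_measurable borel" by measurable
  show "\<bar>G (T - t)\<bar> \<le> G T" if "t \<in> {0..T}" for t
    using that G half_line_distribution_nonneg[OF G, of "T - t"]
    by (auto simp: half_line_distribution_def elim!: monoD)
qed

text \<open>
  As \<open>G (T - t)\<close> is the mass of \<open>{0..T - t}\<close>, the section of the triangle at \<open>t\<close>, the integral
  is the product mass of the triangle. The bound \<open>t \<le> T\<close> is implied by the two other
  conditions on the section, which makes the triangle visibly symmetric in its coordinates.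
\<close>
lemma set_integral_reflected_distribution_eq_nn_integral:
  assumes F: "half_line_distribution F" and G: "half_line_distribution G"
  shows "(LINT t:{0..T}|interval_measure F. G (T - t)) =
    enn2real (\<integral>\<^sup>+t. \<integral>\<^sup>+s. indicator {z. 0 \<le> fst z \<and> 0 \<le> snd z \<and> fst z + snd z \<le> T} (t, s)
      \<partial>interval_measure G \<partial>interval_measure F)"
proof -
  note half_line_distribution_borel[OF G, measurable]
  have "(LINT t:{0..T}|interval_measure F. G (T - t)) =
      enn2real (\<integral>\<^sup>+t. ennreal (indicator {0..T} t *\<^sub>R G (T - t)) \<partial>interval_measure F)"
    unfolding set_lebesgue_integral_def
    by (rule integral_eq_nn_integral) (auto simp: half_line_distribution_nonneg[OF G])
  also have "(\<integral>\<^sup>+t. ennreal (indicator {0..T} t *\<^sub>R G (T - t)) \<partial>interval_measure F) =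
      (\<integral>\<^sup>+t. \<integral>\<^sup>+s. indicator {z. 0 \<le> fst z \<and> 0 \<le> snd z \<and> fst z + snd z \<le> T} (t, s)
        \<partial>interval_measure G \<partial>interval_measure F)"
  proof (rule nn_integral_cong)
    fix t :: real
    have "(\<integral>\<^sup>+s. indicator {z. 0 \<le> fst z \<and> 0 \<le> snd z \<and> fst z + snd z \<le> T} (t, s)
          \<partial>interval_measure G) =
        (\<integral>\<^sup>+s. indicator {0..} t * indicator {0..T - t} s \<partial>interval_measure G)"
      by (rule nn_integral_cong) (auto simp: indicator_def)
    also have "\<dots> = indicator {0..} t * ennreal (G (T - t))"
      by (simp add: nn_integral_cmult emeasure_interval_measure_zero_Icc[OF G])
    also have "\<dots> = ennreal (indicator {0..T} t *\<^sub>R G (T - t))"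
      using G by (auto simp: indicator_def half_line_distribution_def)
    finally show "ennreal (indicator {0..T} t *\<^sub>R G (T - t)) =
        (\<integral>\<^sup>+s. indicator {z. 0 \<le> fst z \<and> 0 \<le> snd z \<and> fst z + snd z \<le> T} (t, s)
          \<partial>interval_measure G)" by simp
  qed
  finally show ?thesis .
qed

lemma set_integral_reflected_distribution_swap:
  assumes F: "half_line_distribution F" and G: "half_line_distribution G"
  shows "(LINT t:{0..T}|interval_measure F. G (T - t)) =
    (LINT s:{0..T}|interval_measure G. F (T - s))"
proof -
  interpret F: sigma_finite_measure "interval_measure F"
    by (rule half_line_distribution_sigma_finite[OF F])
  interpret G: sigma_finite_measure "interval_measure G"
    by (rule half_line_distribution_sigma_finite[OF G])
  interpret pair_sigma_finite "interval_measure F" "interval_measure G" ..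
  let ?\<Delta> = "{z::real \<times> real. 0 \<le> fst z \<and> 0 \<le> snd z \<and> fst z + snd z \<le> T}"
  have sets: "sets (interval_measure F \<Otimes>\<^sub>M interval_measure G) = sets (borel :: (real \<times> real) measure)"
    by (subst borel_prod[symmetric], rule sets_pair_measure_cong) auto
  have "closed ?\<Delta>"
    by (intro closed_Collect_conj closed_Collect_le continuous_intros)
  then have "indicator ?\<Delta> \<in> borel_measurable (interval_measure F \<Otimes>\<^sub>M interval_measure G)"
    by (intro borel_measurable_indicator) (simp only: sets borel_closed)
  then have "(\<integral>\<^sup>+s. \<integral>\<^sup>+t. indicator ?\<Delta> (t, s) \<partial>interval_measure F \<partial>interval_measure G) =
      (\<integral>\<^sup>+t. \<integral>\<^sup>+s. indicator ?\<Delta> (t, s) \<partial>interval_measure G \<partial>interval_measure F)"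
    by (rule Fubini)
  moreover have "indicator ?\<Delta> (t, s) = (indicator ?\<Delta> (s, t) :: ennreal)" for t s
    by (auto simp: indicator_def)
  ultimately show ?thesis
    by (simp add: set_integral_reflected_distribution_eq_nn_integral F G)
qed

lemma set_integrable_sum_mult_right:
  fixes f :: "'i \<Rightarrow> 'a \<Rightarrow> real"
  assumes "\<And>i. i \<in> I \<Longrightarrow> set_integrable M S (f i)"
  shows "set_integrable M S (\<lambda>x. \<Sum>i\<in>I. w i * f i x)"
proof -
  have "integrable M (\<lambda>x. \<Sum>i\<in>I. w i * (indicator S x *\<^sub>R f i x))"
    using assms by (intro Bochner_Integration.integrable_sum integrable_mult_right)
      (simp add: set_integrable_def)
  then show ?thesis
    by (simp add: set_integrable_def sum_distrib_left mult.left_commute)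
qed

lemma set_integral_sum_mult_right:
  fixes f :: "'i \<Rightarrow> 'a \<Rightarrow> real"
  assumes "\<And>i. i \<in> I \<Longrightarrow> set_integrable M S (f i)"
  shows "(LINT x:S|M. \<Sum>i\<in>I. w i * f i x) = (\<Sum>i\<in>I. w i * (LINT x:S|M. f i x))"
proof -
  have "(LINT x:S|M. \<Sum>i\<in>I. w i * f i x) =
      (\<integral>x. (\<Sum>i\<in>I. w i * (indicator S x *\<^sub>R f i x)) \<partial>M)"
    by (simp add: set_lebesgue_integral_def sum_distrib_left mult.left_commute)
  also have "\<dots> = (\<Sum>i\<in>I. w i * (LINT x:S|M. f i x))"
    using assms by (simp add: set_integrable_def set_lebesgue_integral_def Bochner_Integration.integral_sum)
  finally show ?thesis .
qed

section \<open>Controls and their Stieltjes extensions\<close>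

text \<open>
  Non-negativity at \<open>0\<close> makes the jump from \<open>0\<close> to \<open>F 0\<close> upward. Right-continuity is inherited
  from \<open>F\<close> inside \<open>[0,T)\<close> and holds outside because the extension is locally constant to the
  right.
\<close>
lemma half_line_distribution_stieltjes_extension:
  assumes F: "admissible_control T F" and T: "T > 0"
  shows "half_line_distribution (stieltjes_extension T (\<lambda>t. F t $ i))"
proof -
  let ?E = "stieltjes_extension T (\<lambda>t. F t $ i)"
  have mono: "F x $ i \<le> F y $ i" if "0 \<le> x" "x \<le> y" "y \<le> T" for x y
    using F that by (auto simp: admissible_control_def mono_on_def less_eq_vec_def)
  have nonneg: "0 \<le> F x $ i" if "0 \<le> x" "x \<le> T" for x
    using F that by (auto simp: admissible_control_def less_eq_vec_def)
  have "mono ?E"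
    using T by (auto simp: mono_def stieltjes_extension_def intro!: nonneg mono)
  moreover have "continuous (at_right a) ?E" for a
  proof -
    consider "a < 0" | "0 \<le> a" "a < T" | "T \<le> a" by linarith
    then show ?thesis
    proof cases
      case 1
      have "eventually (\<lambda>x. 0 = ?E x) (at_right a)"
        using eventually_at_right_real[OF 1]
        by eventually_elim (simp add: stieltjes_extension_def)
      then have "(?E \<longlongrightarrow> 0) (at_right a)" by (rule Lim_transform_eventually[OF tendsto_const])
      then show ?thesis using 1 by (simp add: continuous_within stieltjes_extension_def)
    next
      case 2
      have "eventually (\<lambda>x. F x $ i = ?E x) (at_right a)"
        using eventually_at_right_real[OF 2(2)]
        by eventually_elim (use 2 in \<open>simp add: stieltjes_extension_def\<close>)
      moreover have "((\<lambda>x. F x $ i) \<longlongrightarrow> F a $ i) (at_right a)"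
        using F 2 by (auto simp: admissible_control_def continuous_within intro: tendsto_vec_nth)
      ultimately have "(?E \<longlongrightarrow> F a $ i) (at_right a)"
        by (rule Lim_transform_eventually[rotated])
      then show ?thesis using 2 by (simp add: continuous_within stieltjes_extension_def)
    next
      case 3
      have "eventually (\<lambda>x. F T $ i = ?E x) (at_right a)"
        using eventually_at_right_less[of a]
        by eventually_elim (use 3 T in \<open>simp add: stieltjes_extension_def\<close>)
      then have "(?E \<longlongrightarrow> F T $ i) (at_right a)" by (rule Lim_transform_eventually[OF tendsto_const])
      then show ?thesis using 3 T by (simp add: continuous_within stieltjes_extension_def)
    qed
  qed
  ultimately show ?thesis
    by (simp add: half_line_distribution_def stieltjes_extension_def)
qed

lemma set_integrable_affine_coordinate:
  fixes v w :: "real ^ 'n"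
  assumes "half_line_distribution F"
  shows "set_integrable (interval_measure F) {0..T} (\<lambda>t. (v + (T - t) *\<^sub>R w) $ i)"
proof (rule set_integrable_interval_measure_bounded[OF assms, where B = "\<bar>v $ i\<bar> + T * \<bar>w $ i\<bar>"])
  show "\<bar>(v + (T - t) *\<^sub>R w) $ i\<bar> \<le> \<bar>v $ i\<bar> + T * \<bar>w $ i\<bar>" if "t \<in> {0..T}" for t
  proof -
    have "\<bar>(T - t) * w $ i\<bar> \<le> T * \<bar>w $ i\<bar>"
      using that by (auto simp: abs_mult intro!: mult_right_mono)
    then show ?thesis by (simp add: order_trans[OF abs_triangle_ineq])
  qed
qed simp

section \<open>Weak duality\<close>

theorem proposition3p1:
  fixes T :: real
    and A :: "real ^ 'j ^ 'k"
    and \<beta> b :: "real ^ 'k"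
    and \<gamma> c :: "real ^ 'j"
    and U :: "real \<Rightarrow> real ^ 'j"
    and P :: "real \<Rightarrow> real ^ 'k"
  assumes "T > 0"
    and "mclp_feasible T A \<beta> b U"
    and "mclp_dual_feasible T A \<gamma> c P"
  shows "mclp_objective T \<gamma> c U \<le> mclp_dual_objective T \<beta> b P"
proof -
  define u where "u j = stieltjes_extension T (\<lambda>t. U t $ j)" for j
  define p where "p k = stieltjes_extension T (\<lambda>t. P t $ k)" for k
  have u: "half_line_distribution (u j)" and p: "half_line_distribution (p k)" for j k
    using assms unfolding u_def p_def mclp_feasible_def mclp_dual_feasible_def
    by (auto intro: half_line_distribution_stieltjes_extension)
  have dual: "(\<gamma> + (T - t) *\<^sub>R c) $ j \<le> (\<Sum>k\<in>UNIV. A $ k $ j * p k (T - t))"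
    if "t \<in> {0..T}" for t j
  proof -
    have "\<gamma> + (T - t) *\<^sub>R c \<le> transpose A *v P (T - t)"
      using assms(3) that by (simp add: mclp_dual_feasible_def)
    then show ?thesis
      using that by (simp add: less_eq_vec_def matrix_vector_mult_def transpose_def p_def
          stieltjes_extension_def)
  qed
  have primal: "(\<Sum>j\<in>UNIV. A $ k $ j * u j (T - s)) \<le> (\<beta> + (T - s) *\<^sub>R b) $ k"
    if "s \<in> {0..T}" for s k
  proof -
    have "A *v U (T - s) \<le> \<beta> + (T - s) *\<^sub>R b"
      using assms(2) that by (simp add: mclp_feasible_def)
    then show ?thesis
      using that by (simp add: less_eq_vec_def matrix_vector_mult_def u_def
          stieltjes_extension_def)
  qed
  have "mclp_objective T \<gamma> c U =
      (\<Sum>j\<in>UNIV. LINT t:{0..T}|interval_measure (u j). (\<gamma> + (T - t) *\<^sub>R c) $ j)"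
    by (simp only: mclp_objective_def stieltjes_integral_def u_def)
  also have "\<dots> \<le> (\<Sum>j\<in>UNIV. LINT t:{0..T}|interval_measure (u j).
      \<Sum>k\<in>UNIV. A $ k $ j * p k (T - t))"
    by (intro sum_mono set_integral_mono set_integrable_affine_coordinate u dual set_integrable_sum_mult_right
        set_integrable_reflected_distribution p) auto
  also have "\<dots> = (\<Sum>j\<in>UNIV. \<Sum>k\<in>UNIV.
      A $ k $ j * (LINT t:{0..T}|interval_measure (u j). p k (T - t)))"
    by (simp add: set_integral_sum_mult_right set_integrable_reflected_distribution u p)
  also have "\<dots> = (\<Sum>k\<in>UNIV. \<Sum>j\<in>UNIV.
      A $ k $ j * (LINT s:{0..T}|interval_measure (p k). u j (T - s)))"
    by (subst sum.swap) (simp add: set_integral_reflected_distribution_swap[OF u p])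
  also have "\<dots> = (\<Sum>k\<in>UNIV. LINT s:{0..T}|interval_measure (p k).
      \<Sum>j\<in>UNIV. A $ k $ j * u j (T - s))"
    by (simp add: set_integral_sum_mult_right set_integrable_reflected_distribution u p)
  also have "\<dots> \<le> (\<Sum>k\<in>UNIV. LINT s:{0..T}|interval_measure (p k). (\<beta> + (T - s) *\<^sub>R b) $ k)"
    by (intro sum_mono set_integral_mono set_integrable_affine_coordinate p primal set_integrable_sum_mult_right
        set_integrable_reflected_distribution u) auto
  also have "\<dots> = mclp_dual_objective T \<beta> b P"
    by (simp only: mclp_dual_objective_def stieltjes_integral_def p_def)
  finally show ?thesis .
qed

end
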